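(* Let $d\ge1$ and $h\ge 1$ be integers. The complete $d$-ary tree $T$ of height $h$ has a $(\leq 2d(d+1)^{h-1})$-subdivision $S$ with $\phi(S)\le 10$.
   Context: An anagram is a word of the form $WP$ where $W$ is a non-empty word and $P$ is a permutation of $W$. A vertex colouring of a graph is anagram-free if the sequence of colours along every path of the graph is not an anagram. $\phi(G)$ is the minimum number of colours in an anagram-free colouring of $G$. A subdivision of $G$ is obtained by replacing each edge $uv$ by a path with endpoints $u,v$; internal vertices are division vertices. A $(\le k)$-subdivision is a subdivision in which every edge receives at most $k$ division vertices. The complete $d$-ary tree of height $h$ is the rooted tree in which every non-leaf vertex has exactly $d$ children and every leaf is at distance $h$ from the root. *)

theory Defs
  imports "Graph_Theory.Pair_Digraph" "Graph_Theory.Vertex_Walk" "HOL-Library.Multiset"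
begin

text \<open>
  Finite simple undirected graphs are modelled as symmetric loop-free digraphs without parallel
  arcs (locale \<^locale>\<open>pair_graph\<close>): an edge \<open>uv\<close> is the pair of arcs \<open>(u, v)\<close> and \<open>(v, u)\<close>. A path
  is its nonempty list of pairwise distinct vertices (\<^const>\<open>vpath\<close>).
\<close>

definition anagram :: "'c list \<Rightarrow> bool" where
  "anagram w \<longleftrightarrow> (\<exists>u p. u \<noteq> [] \<and> mset p = mset u \<and> w = u @ p)"

definition anagram_free_colouring :: "'a pair_pre_digraph \<Rightarrow> ('a \<Rightarrow> 'c) \<Rightarrow> bool" where
  "anagram_free_colouring G c \<longleftrightarrow> (\<forall>p. vpath p (with_proj G) \<longrightarrow> \<not> anagram (map c p))"

text \<open>
  The minimum is attained for every finite graph, see \<open>ex_anagram_free_colouring\<close>; the value is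
  meaningful only for graphs with some finite anagram-free colouring.
\<close>

definition anagram_free_number :: "'a pair_pre_digraph \<Rightarrow> nat" (\<open>\<phi>\<close>) where
  "\<phi> G = (LEAST k. \<exists>c :: 'a \<Rightarrow> nat. c ` pverts G \<subseteq> {..<k} \<and> anagram_free_colouring G c)"

lemma not_anagram_if_distinct: "distinct w \<Longrightarrow> \<not> anagram w"
proof
  assume "distinct w" "anagram w"
  then obtain u p where u: "u \<noteq> []" "mset p = mset u" "w = u @ p"
    unfolding anagram_def by blast
  have "set p = set u" using u(2) by (rule mset_eq_setD)
  with u \<open>distinct w\<close> show False by auto
qed

lemma ex_anagram_free_colouring:
  assumes "finite (pverts G)"
  shows "\<exists>k. \<exists>c :: 'a \<Rightarrow> nat. c ` pverts (G :: 'a pair_pre_digraph) \<subseteq> {..<k}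
    \<and> anagram_free_colouring G c"
proof -
  obtain c :: "'a \<Rightarrow> nat" and n where c: "c ` pverts G = {i. i < n}" "inj_on c (pverts G)"
    using finite_imp_inj_to_nat_seg[OF assms] by metis
  have "anagram_free_colouring G c"
    unfolding anagram_free_colouring_def
  proof (intro allI impI)
    fix p assume "vpath p (with_proj G)"
    then have "distinct p" "set p \<subseteq> pverts G" by (auto simp: vpath_def vwalk_def)
    then have "distinct (map c p)" using c(2) by (auto simp: distinct_map intro: inj_on_subset)
    then show "\<not> anagram (map c p)" by (rule not_anagram_if_distinct)
  qed
  with c(1) show ?thesis by (intro exI[of _ n] exI[of _ c]) auto
qed

text \<open>
  \<open>D (u, v)\<close> lists the division vertices of the edge \<open>uv\<close> in the order from \<open>u\<close> to \<open>v\<close>, so that the edge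
  is replaced by the path \<open>u # D (u, v) @ [v]\<close>. The inductive subdivision relation of
  the Graph Theory library does not record which edge a division vertex belongs to.
\<close>

definition division ::
  "'a pair_pre_digraph \<Rightarrow> ('a \<times> 'a \<Rightarrow> 'a list) \<Rightarrow> 'a pair_pre_digraph \<Rightarrow> bool" where
  "division G D S \<longleftrightarrow>
     (\<forall>(u, v) \<in> parcs G. D (v, u) = rev (D (u, v)))
   \<and> (\<forall>e \<in> parcs G. distinct (D e) \<and> set (D e) \<inter> pverts G = {})
   \<and> (\<forall>(u, v) \<in> parcs G. \<forall>(x, y) \<in> parcs G.
        {u, v} \<noteq> {x, y} \<longrightarrow> set (D (u, v)) \<inter> set (D (x, y)) = {})
   \<and> pverts S = pverts G \<union> (\<Union>e \<in> parcs G. set (D e))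
   \<and> parcs S = (\<Union>(u, v) \<in> parcs G. set (vwalk_arcs (u # D (u, v) @ [v])))"

definition le_subdivision :: "nat \<Rightarrow> 'a pair_pre_digraph \<Rightarrow> 'a pair_pre_digraph \<Rightarrow> bool" where
  "le_subdivision k G S \<longleftrightarrow> (\<exists>D. division G D S \<and> (\<forall>e \<in> parcs G. length (D e) \<le> k))"

text \<open>
  A vertex is the sequence of child indices leading to it from the root \<open>[]\<close>, most recent index
  first; its length is its distance from the root, and the children of \<open>xs\<close> are the vertices \<open>i # xs\<close>.
\<close>

definition complete_tree :: "nat \<Rightarrow> nat \<Rightarrow> nat list pair_pre_digraph" where
  "complete_tree d h =
     (let V = {xs. length xs \<le> h \<and> set xs \<subseteq> {..<d}};
          E = {(xs, i # xs) | xs i. i # xs \<in> V}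
      in \<lparr> pverts = V, parcs = E \<union> E\<inverse> \<rparr>)"

lemma pverts_complete_tree:
  "pverts (complete_tree d h) = {xs. length xs \<le> h \<and> set xs \<subseteq> {..<d}}"
  by (simp add: complete_tree_def Let_def)

lemma parcs_complete_tree:
  "(xs, ys) \<in> parcs (complete_tree d h) \<longleftrightarrow>
     (xs \<in> pverts (complete_tree d h) \<and> ys \<in> pverts (complete_tree d h)
      \<and> ((\<exists>i. ys = i # xs) \<or> (\<exists>i. xs = i # ys)))"
  by (auto simp: complete_tree_def Let_def)

lemma pair_graph_complete_tree: "pair_graph (complete_tree d h)"
proof
  have "finite {xs. set xs \<subseteq> {..<d} \<and> length xs \<le> h}"
    by (rule finite_lists_length_le) simp
  then show fin: "finite (pverts (complete_tree d h))"
    by (simp add: pverts_complete_tree conj_commute)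
  have sub: "parcs (complete_tree d h) \<subseteq> pverts (complete_tree d h) \<times> pverts (complete_tree d h)"
    by (auto simp: parcs_complete_tree)
  then show "finite (parcs (complete_tree d h))"
    using fin finite_subset by blast
  show "fst e \<in> pverts (complete_tree d h)" "snd e \<in> pverts (complete_tree d h)"
    if "e \<in> parcs (complete_tree d h)" for e using that sub by auto
  show "fst e \<noteq> snd e" if "e \<in> parcs (complete_tree d h)" for e
    using that by (cases e) (auto simp: parcs_complete_tree)
  show "symmetric (with_proj (complete_tree d h))"
    by (auto simp: symmetric_def sym_def parcs_complete_tree)
qed

lemma card_children_complete_tree:
  assumes "xs \<in> pverts (complete_tree d h)" "length xs < h"
  shows "card {ys. (xs, ys) \<in> parcs (complete_tree d h) \<and> length ys = Suc (length xs)} = d"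
proof -
  have "(xs, ys) \<in> parcs (complete_tree d h) \<and> length ys = Suc (length xs)
    \<longleftrightarrow> (\<exists>i<d. ys = i # xs)" for ys
  proof
    assume "(xs, ys) \<in> parcs (complete_tree d h) \<and> length ys = Suc (length xs)"
    then have ys: "ys \<in> pverts (complete_tree d h)" "length ys = Suc (length xs)"
      "(\<exists>i. ys = i # xs) \<or> (\<exists>i. xs = i # ys)"
      unfolding parcs_complete_tree by blast+
    from ys(3) obtain i where i: "ys = i # xs"
      using ys(2) by (elim disjE exE) simp_all
    with ys(1) have "i < d" by (simp add: pverts_complete_tree)
    with i show "\<exists>i<d. ys = i # xs" by blast
  next
    assume "\<exists>i<d. ys = i # xs"
    then obtain i where i: "i < d" "ys = i # xs" by blast
    with assms have "ys \<in> pverts (complete_tree d h)" by (simp add: pverts_complete_tree)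
    with assms(1) i(2) show "(xs, ys) \<in> parcs (complete_tree d h) \<and> length ys = Suc (length xs)"
      unfolding parcs_complete_tree by simp
  qed
  then have "{ys. (xs, ys) \<in> parcs (complete_tree d h) \<and> length ys = Suc (length xs)}
    = (\<lambda>i. i # xs) ` {..<d}"
    by blast
  then show ?thesis by (simp add: card_image inj_on_def)
qed

lemma parent_complete_tree:
  assumes "ys \<in> pverts (complete_tree d h)" "ys \<noteq> []"
  shows "{xs. (xs, ys) \<in> parcs (complete_tree d h) \<and> length xs < length ys} = {tl ys}"
proof -
  from assms(2) obtain i zs where ys: "ys = i # zs" by (cases ys) simp_all
  with assms(1) have "zs \<in> pverts (complete_tree d h)" by (simp add: pverts_complete_tree)
  then have "(xs, ys) \<in> parcs (complete_tree d h) \<and> length xs < length ys \<longleftrightarrow> xs = zs" for xs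
    using assms(1) unfolding parcs_complete_tree ys
    by (metis length_Cons lessI list.inject not_less_iff_gr_or_eq)
  then show ?thesis by (simp add: ys)
qed

lemma vwalk_arcs_snoc:
  "vwalk_arcs (xs @ [y, x]) = vwalk_arcs (xs @ [y]) @ [(y, x)]"
  by (induction xs rule: vwalk_arcs.induct) simp_all

lemma vwalk_arcs_rev: "set (vwalk_arcs (rev xs)) = (set (vwalk_arcs xs))\<inverse>"
proof (induction xs rule: vwalk_arcs.induct)
  case (3 x y xs)
  have "set (vwalk_arcs (rev (x # y # xs))) = insert (y, x) (set (vwalk_arcs (rev (y # xs))))"
    using vwalk_arcs_snoc[of "rev xs" y x] by simp
  also have "\<dots> = (set (vwalk_arcs (x # y # xs)))\<inverse>"
    by (simp only: 3) auto
  finally show ?case .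
qed simp_all

lemma vwalk_arcs_distinct:
  "distinct xs \<Longrightarrow> (x, y) \<in> set (vwalk_arcs xs) \<Longrightarrow> x \<in> set xs \<and> y \<in> set xs \<and> x \<noteq> y"
  by (induction xs rule: vwalk_arcs.induct) auto

lemma pair_graph_division:
  assumes "pair_graph G" and S: "division G D S"
  shows "pair_graph S"
proof -
  interpret G: pair_graph G by fact
  have arcs: "x \<in> pverts S \<and> y \<in> pverts S \<and> x \<noteq> y \<and> (y, x) \<in> parcs S"
    if "(x, y) \<in> parcs S" for x y
  proof -
    from that S obtain u v where
      uv: "(u, v) \<in> parcs G" "(x, y) \<in> set (vwalk_arcs (u # D (u, v) @ [v]))"
      by (auto simp: division_def)
    let ?p = "u # D (u, v) @ [v]"
    have "u \<in> pverts G" "v \<in> pverts G" "u \<noteq> v" using uv(1) G.in_arcsD1 G.in_arcsD2 G.no_loops' by auto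
    moreover have "distinct (D (u, v))" "set (D (u, v)) \<inter> pverts G = {}"
      using S uv(1) by (auto simp: division_def)
    ultimately have "distinct ?p" by auto
    moreover have "set ?p \<subseteq> pverts S"
      using \<open>u \<in> pverts G\<close> \<open>v \<in> pverts G\<close> S uv(1) by (auto simp: division_def)
    moreover have "(v, u) \<in> parcs G" using uv(1) G.pair_sym_arcs by (auto simp: symmetric_def sym_def)
    moreover have "D (v, u) = rev (D (u, v))" using S uv(1) by (auto simp: division_def)
    then have "v # D (v, u) @ [u] = rev ?p" by simp
    then have "(y, x) \<in> set (vwalk_arcs (v # D (v, u) @ [u]))"
      using uv(2) by (simp only: vwalk_arcs_rev converse_iff)
    moreover have "(v, u) \<in> parcs G \<Longrightarrow> (y, x) \<in> parcs S"
      if "(y, x) \<in> set (vwalk_arcs (v # D (v, u) @ [u]))"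
      using S that unfolding division_def by blast
    ultimately show ?thesis
      using vwalk_arcs_distinct[OF _ uv(2)] by blast
  qed
  have fin: "finite (pverts S)" "finite (parcs S)"
    using S by (simp_all add: division_def case_prod_unfold)
  show ?thesis
  proof
    show "symmetric (with_proj S)" using arcs by (simp add: symmetric_def sym_def)
  qed (use arcs fin in auto)
qed

end

(*
  A path of the subdivided tree climbs to its highest vertex and then descends. Along every edge
  letters of a word w alternate with markers, where the letter is read off from the distance to the
  root; if w is an anagram-free word over six letters, then no ascending path is an anagram. The four
  remaining colours are one for the original vertices and three markers.

  If the edge above the child with index i of a vertex at distance h - 1 - k from the root receives
  2n division vertices, n = (i + 1) (d + 1)^k, then the number n of its letters is a digit in base
  d + 1. The markers are rho on the upper half of the edge, nu on the lower half and, for odd n,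
  sigma in the middle, so that both 2 #rho + #sigma and 2 #nu + #sigma count n per edge, but the
  first saturates in the upper half before the second one starts to grow. Suppose a bent path from
  x over the top t to y is an anagram whose second half starts at a vertex m between x and t.
  Comparing rho-counts, m has to lie in the upper half of the edge below t. Then the nu-counts of
  x and y agree, while x is separated from t by one more original vertex than y. Since different
  branches at t have different leading digits, y must lie in the lower half of the first edge of a
  branch with a larger digit than that of x, and there its rho-count exceeds that of x.

  Anagram-free words over six letters are obtained by iterating a morphism in the style of Dekking:
  the letters carry weights modulo N such that every block has weight 0, and the weights of the cut
  points inside the blocks contain no three-term arithmetic progression. An anagram in the image
  of a word gives three cut points whose weights form a progression, so all three cut the blocks
  in the same way, and the anagram comes from one in the original word because the Parikh matrix of
  the morphism is invertible. The morphism was found by computer search.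
*)

theory Submission
  imports Defs "HOL-Library.Sublist"
begin

section \<open>Anagram-free words over six letters\<close>

definition anagram_free :: "'c list \<Rightarrow> bool" where
  "anagram_free w \<longleftrightarrow> (\<forall>u. sublist u w \<longrightarrow> \<not> anagram u)"

lemma anagram_rev: "anagram (rev w) \<longleftrightarrow> anagram w"
proof -
  have "anagram (rev w)" if "anagram w" for w :: "'c list"
    using that unfolding anagram_def by (metis mset_rev mset_zero_iff rev_append rev_is_Nil_conv)
  from this[of w] this[of "rev w"] show ?thesis by auto
qed

section \<open>A morphism on six letters, its cut vectors and their weights\<close>

definition block :: "nat \<Rightarrow> nat list" where
  "block a = [[3,0,5,4,0,4], [1,5,3,1,0,5,3,2,3,4], [1,5,3,1,0,4,5,1,5,0,5], [3,2,5,2,4,0,5,0,2,0,5],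
     [1,2,1,0,2,1,2,3,0,2,0,5], [1,2,4,2,3,4,0,4,2,1,4,1,3,4]] ! a"

definition morph :: "nat list \<Rightarrow> nat list" where
  "morph w = concat (map block w)"

definition parikh :: "nat list \<Rightarrow> int list" where
  "parikh w = map (\<lambda>c. int (count_list w c)) [0..<6]"

text \<open>
  A cut of a block is represented by the Parikh vector of the part before it, or by minus the Parikh
  vector of the part after it: these agree modulo the Parikh vectors of whole blocks, and the choice
  makes common prefixes and common suffixes of different blocks contribute the same vectors.
\<close>

definition cut :: "nat \<Rightarrow> nat \<Rightarrow> int list" where
  "cut a j = (if 2 * j \<le> length (block a) + 1 then parikh (take j (block a))
     else map uminus (parikh (drop j (block a))))"

definition cuts :: "int list list" where
  "cuts = remdups (concat (map (\<lambda>a. map (cut a) [0..<Suc (length (block a))]) [0..<6]))"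

text \<open>The linear functional of Dekking's method. Its coefficients are chosen so that every
  block has weight 0 modulo 1447, while the weights of the cuts are distinct residues without
  nontrivial three-term progressions.\<close>

definition weight :: "int list \<Rightarrow> int" where
  "weight v = sum_list (map2 (*) [-215, 59, 140, -120, 261, 28] v)"

text \<open>The factor 724 is the inverse of 2 modulo 1447, so the test looks for midpoints.\<close>

definition ap_free :: "int list \<Rightarrow> bool" where
  "ap_free S \<longleftrightarrow> list_all (\<lambda>x. list_all (\<lambda>z. x = z \<or> \<not> List.member S ((x + z) * 724 mod 1447)) S) S"

lemma residues: "distinct (map (\<lambda>v. weight v mod 1447) cuts)" "ap_free (map (\<lambda>v. weight v mod 1447) cuts)"
  by code_simp+

lemma weight_block: "list_all (\<lambda>a. weight (parikh (block a)) mod 1447 = 0) [0..<6]"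
  by code_simp

text \<open>Subtracting the whole block from the Parikh vector of the part before a cut leaves minus
  that of the part after it, so the alternatives are the two representations of a cut.\<close>

lemma cut_block: "list_all (\<lambda>a. list_all (\<lambda>j. parikh (take j (block a)) \<in> set cuts
    \<or> map2 (-) (parikh (take j (block a))) (parikh (block a)) \<in> set cuts) [0..<Suc (length (block a))]) [0..<6]"
  by code_simp

lemma block_letters: "list_all (\<lambda>a. list_all (\<lambda>b. b < 6) (block a) \<and> 2 \<le> length (block a)) [0..<6]"
  by code_simp

lemma length_cuts: "list_all (\<lambda>v. length v = 6) cuts"
  by code_simp

section \<open>Parikh vectors of images of words and of their prefixes\<close>

lemma morph_simps [simp]:
  "morph [] = []" "morph (a # w) = block a @ morph w" "morph (u @ v) = morph u @ morph v"
  by (simp_all add: morph_def)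

lemma block_lt: "a < 6 \<Longrightarrow> b \<in> set (block a) \<Longrightarrow> b < 6"
  using block_letters by (fastforce simp: list_all_iff)

lemma length_block: "a < 6 \<Longrightarrow> 2 \<le> length (block a)"
  using block_letters by (auto simp: list_all_iff)

lemma set_morph: "set w \<subseteq> {..<6} \<Longrightarrow> set (morph w) \<subseteq> {..<6}"
  by (induction w) (auto dest: block_lt)

lemma length_morph: "set w \<subseteq> {..<6} \<Longrightarrow> 2 * length w \<le> length (morph w)"
proof (induction w)
  case (Cons a w)
  then show ?case using length_block[of a] by simp
qed simp

lemma nth_parikh: "c < 6 \<Longrightarrow> parikh w ! c = int (count_list w c)"
  unfolding parikh_def by (subst nth_map) (simp_all only: length_upt nth_upt add_0 diff_zero)

lemma length_parikh [simp]: "length (parikh w) = 6"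
  by (simp add: parikh_def)

lemma cuts_zero: "replicate 6 0 \<in> set cuts"
  by code_simp

text \<open>Peeling off blocks from the front reduces a prefix to one that ends inside the current
  block; \<open>cut_block\<close> applies there.\<close>

lemma cut_morph:
  assumes "set w \<subseteq> {..<6}" "j \<le> length (morph w)"
  shows "\<exists>n\<le>length w. \<exists>\<delta>\<in>set cuts. \<forall>c<6.
    int (count_list (take j (morph w)) c) = int (count_list (morph (take n w)) c) + \<delta> ! c"
  using assms
proof (induction w arbitrary: j)
  case Nil
  then show ?case by (auto intro!: bexI[OF _ cuts_zero])
next
  case (Cons a w)
  have a: "a < 6" using Cons.prems by simp
  show ?case
  proof (cases "j \<le> length (block a)")
    case True
    with cut_block a consider "parikh (take j (block a)) \<in> set cuts"
      | "map2 (-) (parikh (take j (block a))) (parikh (block a)) \<in> set cuts"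
      by (fastforce simp: list_all_iff)
    then show ?thesis
    proof cases
      case 1
      then show ?thesis using True
        by (intro exI[of _ 0] conjI bexI[OF _ 1]) (simp_all add: nth_parikh)
    next
      \<comment> \<open>This representation counts the block that is cut among the whole ones, hence
        one block instead of none.\<close>
      case 2
      then show ?thesis using True
        by (intro exI[of _ 1] conjI bexI[OF _ 2]) (simp_all add: nth_parikh)
    qed
  next
    case False
    then have "j - length (block a) \<le> length (morph w)" using Cons.prems by simp
    with Cons.IH[of "j - length (block a)"] Cons.prems(1) obtain n \<delta> where "n \<le> length w" "\<delta> \<in> set cuts" and
      "\<forall>c<6. int (count_list (take (j - length (block a)) (morph w)) c)
        = int (count_list (morph (take n w)) c) + \<delta> ! c"
      by auto
    then show ?thesis using False
      by (intro exI[of _ "Suc n"] conjI bexI[of _ \<delta>]) simp_all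
  qed
qed

lemma weight_eq_sum:
  assumes "length v = 6"
  shows "weight v = (\<Sum>c<6. [-215, 59, 140, -120, 261, 28] ! c * v ! c)"
proof -
  have "{..<6} = {0, 1, 2, 3, 4, 5 :: nat}" by auto
  moreover obtain p q r s t u where "v = [p, q, r, s, t, u]"
    using assms by (auto simp: numeral_eq_Suc length_Suc_conv)
  ultimately show ?thesis by (simp add: weight_def)
qed

lemma weight_parikh_morph:
  "set w \<subseteq> {..<6} \<Longrightarrow> weight (parikh (morph w)) mod 1447 = 0"
proof (induction w)
  case Nil
  then show ?case by (simp add: weight_eq_sum nth_parikh)
next
  case (Cons a w)
  have "weight (parikh (morph (a # w))) = weight (parikh (block a)) + weight (parikh (morph w))"
    by (simp add: weight_eq_sum nth_parikh algebra_simps sum.distrib)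
  moreover have "weight (parikh (block a)) mod 1447 = 0"
    using weight_block Cons.prems by (simp add: list_all_iff)
  ultimately show ?case using Cons by (simp add: mod_add_eq[symmetric, of "weight (parikh (block a))"])
qed

text \<open>The residue of \<open>y\<close> is the midpoint of those of \<open>x\<close> and
  \<open>z\<close>, which \<open>ap_free\<close> allows only if these coincide; injectivity on
  \<open>cuts\<close> turns equal residues into equal vectors.\<close>

lemma cuts_progression:
  assumes "x \<in> set cuts" "y \<in> set cuts" "z \<in> set cuts"
    and "(weight x + weight z) mod 1447 = (2 * weight y) mod 1447"
  shows "x = y \<and> z = y"
proof -
  define r where "r v = weight v mod 1447" for v
  have inj: "u = v" if "r u = r v" "u \<in> set cuts" "v \<in> set cuts" for u v
    using residues(1) that unfolding distinct_map inj_on_def r_def by blast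
  have ap: "u = v" if "(r u + r v) * 724 mod 1447 \<in> r ` set cuts" "u \<in> set cuts" "v \<in> set cuts" for u v
    using residues(2) that inj[of u v] unfolding ap_free_def r_def[symmetric]
    by (force simp: list_all_iff)
  have half: "2 * k * 724 mod 1447 = k mod 1447" for k :: int
  proof -
    have "2 * k * 724 = k + 1447 * k" by simp
    then show ?thesis by (simp only: mod_mult_self2)
  qed
  have "(r x + r z) * 724 mod 1447 = (weight x + weight z) * 724 mod 1447"
    unfolding r_def by (metis mod_add_eq mod_mult_left_eq)
  also have "\<dots> = (2 * weight y) * 724 mod 1447"
    using assms(4) by (metis mod_mult_left_eq)
  also have "\<dots> = r y" unfolding r_def by (rule half)
  finally have *: "(r x + r z) * 724 mod 1447 = r y" .
  then have "x = z" using assms(1-3) by (intro ap) simp_all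
  with * have "2 * r x * 724 mod 1447 = r y" by (simp only: mult_2)
  then have "r x = r y" unfolding half by (simp only: r_def mod_mod_trivial)
  with assms(1,2) \<open>x = z\<close> inj show ?thesis by metis
qed

lemma count_list_morph:
  "set w \<subseteq> {..<6} \<Longrightarrow> count_list (morph w) c = (\<Sum>a<6. count_list (block a) c * count_list w a)"
proof (induction w)
  case (Cons a w)
  have "(\<Sum>b<6. count_list (block b) c * count_list (a # w) b)
    = (\<Sum>b<6. count_list (block b) c * count_list w b + (if b = a then count_list (block b) c else 0))"
    by (intro sum.cong) auto
  also have "\<dots> = count_list (morph w) c + count_list (block a) c"
    using Cons by (subst sum.distrib) simp
  finally show ?case by simp
qed simp

lemma mset_eq_iff_count_list:
  assumes "set u \<subseteq> A" "set v \<subseteq> A"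
  shows "mset u = mset v \<longleftrightarrow> (\<forall>c\<in>A. count_list u c = count_list v c)"
proof -
  have "count_list u c = count_list v c" if "c \<notin> A" for c
    using that assms by (metis count_list_0_iff subsetD)
  then show ?thesis by (auto simp: multiset_eq_iff count_mset)
qed

text \<open>The letter counts of an image are six linear forms in the letter counts of the word.
  Their coefficient matrix is nonsingular, so linear arithmetic recovers the latter.\<close>

lemma morph_mset_inj:
  assumes X: "set X \<subseteq> {..<6}" and Y: "set Y \<subseteq> {..<6}"
    and eq: "\<And>c. c < 6 \<Longrightarrow> count_list (morph X) c = count_list (morph Y) c"
  shows "mset X = mset Y"
proof -
  have six: "{..<6} = {0, 1, 2, 3, 4, 5 :: nat}" by auto
  have "\<forall>c\<in>{..<6}. count_list X c = count_list Y c"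
    using eq[of 0] eq[of 1] eq[of 2] eq[of 3] eq[of 4] eq[of 5]
    unfolding count_list_morph[OF X] count_list_morph[OF Y]
    apply (simp add: six block_def del: One_nat_def)
    done
  with X Y show ?thesis by (simp add: mset_eq_iff_count_list)
qed

lemma anagram_free_morph:
  assumes w: "set w \<subseteq> {..<6}" and af: "anagram_free w"
  shows "anagram_free (morph w)"
  unfolding anagram_free_def
proof (intro allI impI notI)
  fix q assume "sublist q (morph w)" "anagram q"
  then obtain \<alpha> \<beta> U V where split: "morph w = \<alpha> @ U @ V @ \<beta>" and U: "U \<noteq> []" and UV: "mset V = mset U"
    by (auto simp: sublist_def anagram_def)
  have letters: "set U \<subseteq> {..<6}" using set_morph[OF w] unfolding split by auto
  let ?g = "\<lambda>c. [-215, 59, 140, -120, 261, 28 :: int] ! c"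
  let ?C = "\<lambda>v c. int (count_list v c)"
  have eqC: "?C U c = ?C V c" for c using UV by (metis count_mset)
  \<comment> \<open>Whole blocks have weight 0 modulo 1447, so the weight of a cut is that of the
    entire prefix.\<close>
  have "\<exists>n\<le>length w. \<exists>\<delta>\<in>set cuts. (\<forall>c<6. ?C p c = ?C (morph (take n w)) c + \<delta> ! c)
    \<and> weight \<delta> mod 1447 = (\<Sum>c<6. ?g c * ?C p c) mod 1447"
    if p: "prefix p (morph w)" for p
  proof -
    from p obtain j where j: "p = take j (morph w)" "j \<le> length (morph w)"
      by (metis append_eq_conv_conj prefix_def prefix_length_le)
    from cut_morph[OF w j(2)] obtain n \<delta> where n: "n \<le> length w" "\<delta> \<in> set cuts"
      "\<forall>c<6. ?C p c = ?C (morph (take n w)) c + \<delta> ! c" unfolding j(1) by blast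
    have len: "length \<delta> = 6" using length_cuts n(2) by (simp add: list_all_iff)
    have "(\<Sum>c<6. ?g c * ?C p c) = (\<Sum>c<6. ?g c * ?C (morph (take n w)) c) + (\<Sum>c<6. ?g c * \<delta> ! c)"
      using n(3) by (simp add: sum.distrib[symmetric] algebra_simps)
    also have "\<dots> = weight (parikh (morph (take n w))) + weight \<delta>"
      by (simp add: weight_eq_sum len nth_parikh)
    finally have sum: "(\<Sum>c<6. ?g c * ?C p c) = weight (parikh (morph (take n w))) + weight \<delta>" .
    have "weight (parikh (morph (take n w))) mod 1447 = 0"
      by (rule weight_parikh_morph) (use w in \<open>auto dest: in_set_takeD\<close>)
    then obtain k where "weight (parikh (morph (take n w))) = 1447 * k"
      by (metis mod_0_imp_dvd dvdE)
    then have "weight \<delta> mod 1447 = (\<Sum>c<6. ?g c * ?C p c) mod 1447"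
      unfolding sum by simp
    with n show ?thesis by blast
  qed
  note cut = this
  have pre: "prefix \<alpha> (morph w)" "prefix (\<alpha> @ U) (morph w)" "prefix (\<alpha> @ U @ V) (morph w)"
    unfolding split by (simp_all add: prefix_def)
  obtain n1 x where 1: "n1 \<le> length w" "x \<in> set cuts"
    "\<And>c. c < 6 \<Longrightarrow> ?C \<alpha> c = ?C (morph (take n1 w)) c + x ! c"
    "weight x mod 1447 = (\<Sum>c<6. ?g c * ?C \<alpha> c) mod 1447"
    using cut[OF pre(1)] by blast
  obtain n2 y where 2: "n2 \<le> length w" "y \<in> set cuts"
    "\<And>c. c < 6 \<Longrightarrow> ?C (\<alpha> @ U) c = ?C (morph (take n2 w)) c + y ! c"
    "weight y mod 1447 = (\<Sum>c<6. ?g c * ?C (\<alpha> @ U) c) mod 1447"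
    using cut[OF pre(2)] by blast
  obtain n3 z where 3: "n3 \<le> length w" "z \<in> set cuts"
    "\<And>c. c < 6 \<Longrightarrow> ?C (\<alpha> @ U @ V) c = ?C (morph (take n3 w)) c + z ! c"
    "weight z mod 1447 = (\<Sum>c<6. ?g c * ?C (\<alpha> @ U @ V) c) mod 1447"
    using cut[OF pre(3)] by blast
  \<comment> \<open>\<open>U\<close> and \<open>V\<close> have the same Parikh vector, so the
    weights of the three prefixes are in arithmetic progression.\<close>
  have sum: "(\<Sum>c<6. ?g c * ?C \<alpha> c) + (\<Sum>c<6. ?g c * ?C (\<alpha> @ U @ V) c) = 2 * (\<Sum>c<6. ?g c * ?C (\<alpha> @ U) c)"
    by (simp add: eqC sum.distrib[symmetric] sum_distrib_left algebra_simps)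
  have prog: "(weight x + weight z) mod 1447 = (2 * weight y) mod 1447"
    unfolding mod_add_cong[OF 1(4) 3(4)] mod_mult_cong[OF refl 2(4)] sum ..
  have xyz: "y = x" "z = x" using cuts_progression[OF 1(2) 2(2) 3(2) prog] by simp_all
  have C1: "?C (morph (take n2 w)) c = ?C (morph (take n1 w)) c + ?C U c" if "c < 6" for c
    using 1(3)[OF that] 2(3)[OF that] xyz by simp
  have C2: "?C (morph (take n3 w)) c = ?C (morph (take n2 w)) c + ?C U c" if "c < 6" for c
    using 2(3)[OF that] 3(3)[OF that] xyz eqC[of c] by simp
  \<comment> \<open>A letter of \<open>U\<close> occurs in both halves. With equal cut vectors its
    count must grow between the whole-block prefixes, which makes \<open>n1\<close>,
    \<open>n2\<close>, \<open>n3\<close> strictly increasing.\<close>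
  obtain c where c: "c < 6" "0 < ?C U c"
    using U letters by (cases U) auto
  have mono: "?C (morph (take m w)) c \<le> ?C (morph (take n w)) c" if "m \<le> n" for m n
    
  proof -
    have "take n w = take m w @ take (n - m) (drop m w)" using that by (simp add: take_add[symmetric])
    then show ?thesis by simp
  qed
  have lt: "n1 < n2" "n2 < n3"
    using mono[of n2 n1] mono[of n3 n2] C1[OF c(1)] C2[OF c(1)] c(2) by linarith+
  define X Y where "X = take (n2 - n1) (drop n1 w)" and "Y = take (n3 - n2) (drop n2 w)"
  have X: "take n2 w = take n1 w @ X" and Y: "take n3 w = take n2 w @ Y"
    using lt by (simp_all add: X_def Y_def take_add[symmetric])
  have sX: "set X \<subseteq> {..<6}" "set Y \<subseteq> {..<6}"
    using w by (auto simp: X_def Y_def dest!: in_set_takeD in_set_dropD)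
  have "mset X = mset Y"
    using sX by (rule morph_mset_inj) (use C1 C2 in \<open>simp add: X Y\<close>)
  moreover have "X \<noteq> []" using lt 1 2 by (simp add: X_def)
  ultimately have "anagram (X @ Y)" unfolding anagram_def by metis
  moreover have "w = take n1 w @ (X @ Y) @ drop n3 w"
    by (metis X Y append.assoc append_take_drop_id)
  then have "sublist (X @ Y) w" unfolding sublist_def by metis
  ultimately show False using af unfolding anagram_free_def by blast
qed

text \<open>Starting from the word \<open>[0]\<close>, each application of \<open>morph\<close> at
  least doubles the length, as every block has two or more letters.\<close>

lemma ex_anagram_free_word:
  "\<exists>w. n \<le> length w \<and> set w \<subseteq> {..<6 :: nat} \<and> anagram_free w"
proof -
  have "2 ^ k \<le> length ((morph ^^ k) [0]) \<and> set ((morph ^^ k) [0]) \<subseteq> {..<6} \<and> anagram_free ((morph ^^ k) [0])" for k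
  proof (induction k)
    case 0
    have "\<not> anagram u" if "sublist u [0 :: nat]" for u
    proof -
      have "distinct u" using that by (auto simp: sublist_def Cons_eq_append_conv append_eq_Cons_conv)
      then show ?thesis by (rule not_anagram_if_distinct)
    qed
    then show ?case by (simp add: anagram_free_def)
  next
    case (Suc k)
    then show ?case
      using anagram_free_morph set_morph length_morph[of "(morph ^^ k) [0]"] by auto
  qed
  from this[of n] show ?thesis using less_exp[of n] less_imp_le order_trans by metis
qed

section \<open>The subdivided tree\<close>

lemma set_vwalk_arcs_subset: "set (vwalk_arcs p) \<subseteq> R \<longleftrightarrow> successively (\<lambda>x y. (x, y) \<in> R) p"
  by (induction p rule: vwalk_arcs.induct) auto

section \<open>Paths in rooted forests\<close>

locale rooted_forest =
  fixes root :: "'v \<Rightarrow> bool" and par :: "'v \<Rightarrow> 'v"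
begin

definition up :: "'v \<Rightarrow> 'v \<Rightarrow> bool" where
  "up x y \<longleftrightarrow> \<not> root x \<and> y = par x"

abbreviation ascending :: "'v list \<Rightarrow> bool" where
  "ascending \<equiv> successively up"

lemma path_split:
  assumes "distinct p" "p \<noteq> []" "successively (\<lambda>x y. up x y \<or> up y x) p"
  obtains us t vs where "p = us @ t # rev vs" "ascending (us @ [t])" "ascending (vs @ [t])"
proof -
  have "\<exists>us t vs. p = us @ t # rev vs \<and> ascending (us @ [t]) \<and> ascending (vs @ [t])"
    using assms
  proof (induction p)
    case (Cons x p)
    show ?case
    proof (cases "p = []")
      case True
      then show ?thesis by (intro exI[of _ "[]"] exI[of _ x]) simp
    next
      case False
      with Cons obtain us t vs where p: "p = us @ t # rev vs" "ascending (us @ [t])" "ascending (vs @ [t])"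
        by (auto simp: successively_Cons)
      from Cons.prems False have hd: "up x (hd p) \<or> up (hd p) x" "x \<notin> set p"
        by (auto simp: successively_Cons)
      show ?thesis
      proof (cases "up x (hd p)")
        case True
        then have "ascending ((x # us) @ [t])"
          using p(1,2) by (cases us) auto
        with p show ?thesis by (intro exI[of _ "x # us"] exI[of _ t] exI[of _ vs]) simp
      next
        case down: False
        then have up: "up (hd p) x" using hd by simp
        \<comment> \<open>If the remaining path first climbed, its second vertex would be the parent
          of its first, which is \<open>x\<close>; but \<open>x\<close> does not recur.\<close>
        have "us = []"
        proof (rule ccontr)
          assume "us \<noteq> []"
          then obtain u us' where us: "us = u # us'" by (cases us) auto
          then have "up u (hd (us' @ [t]))" "up u x" using p up by (cases us'; auto)+
          then have "x = hd (us' @ [t])" by (simp add: up_def)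
          then show False using hd(2) p(1) us by (cases us') auto
        qed
        with p up show ?thesis
          by (intro exI[of _ "[]"] exI[of _ x] exI[of _ "vs @ [t]"]) (auto simp: successively_append_iff)
      qed
    qed
  qed simp
  with that show thesis by blast
qed

text \<open>The sum telescopes. \<open>F\<close> will be a running count of colours from the root,
  and \<open>g\<close> its increment.\<close>

lemma ascending_sum:
  fixes F :: "'v \<Rightarrow> nat"
  assumes "ascending (xs @ [m])" and "\<And>x. x \<in> set xs \<Longrightarrow> \<not> root x \<Longrightarrow> F x = F (par x) + g x"
  shows "sum_list (map g xs) + F m = F (hd (xs @ [m]))"
  using assms
proof (induction xs)
  case (Cons x xs)
  then have "up x (hd (xs @ [m]))" "ascending (xs @ [m])" by (auto simp: successively_Cons)
  with Cons show ?case by (auto simp: up_def)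
qed simp

end

text \<open>The number of letters between the root and a vertex, as a number in base
  \<open>d + 1\<close>: the edge to child \<open>i\<close> contributes the nonzero digit
  \<open>i + 1\<close>, at the position given by the height of the child.\<close>

primrec depth :: "nat \<Rightarrow> nat \<Rightarrow> nat list \<Rightarrow> nat" where
  "depth d h [] = 0"
| "depth d h (i # v) = depth d h v + (i + 1) * (d + 1) ^ (h - Suc (length v))"

text \<open>The number of letters on the edge above \<open>v\<close>, and also the position at which
  its markers change from rho to nu.\<close>

definition half :: "nat \<Rightarrow> nat \<Rightarrow> nat list \<Rightarrow> nat" where
  "half d h v = (hd v + 1) * (d + 1) ^ (h - length v)"

text \<open>
  The division vertices of the edge above \<open>v\<close> are \<open>(d + r) # v\<close>, numbered downwards by \<open>r\<close>; they are no
  tree vertices as \<open>d + r\<close> is not a child index.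
\<close>

definition segment :: "nat \<Rightarrow> nat \<Rightarrow> nat list \<Rightarrow> nat list list" where
  "segment d h v = map (\<lambda>r. (d + r) # v) [0..<2 * half d h v]"

definition divs :: "nat \<Rightarrow> nat \<Rightarrow> nat list \<times> nat list \<Rightarrow> nat list list" where
  "divs d h e = (if length (fst e) < length (snd e) then segment d h (snd e) else rev (segment d h (fst e)))"

definition subdivided_tree :: "nat \<Rightarrow> nat \<Rightarrow> nat list pair_pre_digraph" where
  "subdivided_tree d h = (let T = complete_tree d h in
    \<lparr> pverts = pverts T \<union> (\<Union>e \<in> parcs T. set (divs d h e)),
      parcs = \<Union>(u, v) \<in> parcs T. set (vwalk_arcs (u # divs d h (u, v) @ [v])) \<rparr>)"

lemma half_pos: "0 < half d h v"
  by (simp add: half_def)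

lemma depth_Cons: "depth d h (i # v) = depth d h v + half d h (i # v)"
  by (simp add: half_def)

lemma parcs_complete_treeE:
  assumes "(u, v) \<in> parcs (complete_tree d h)"
  obtains i where "v = i # u" "v \<in> pverts (complete_tree d h)"
    | i where "u = i # v" "u \<in> pverts (complete_tree d h)"
  using assms by (auto simp: parcs_complete_tree)

lemma set_segment: "x \<in> set (segment d h v) \<longleftrightarrow> (\<exists>r<2 * half d h v. x = (d + r) # v)"
  by (auto simp: segment_def)

lemma set_divs:
  "set (divs d h (u, v)) = set (segment d h (if length u < length v then v else u))"
  by (simp add: divs_def)

lemma division_subdivided_tree:
  "division (complete_tree d h) (divs d h) (subdivided_tree d h)"
proof -
  let ?T = "complete_tree d h"
  have 1: "divs d h (v, u) = rev (divs d h (u, v))" if "(u, v) \<in> parcs ?T" for u v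
    using that by (elim parcs_complete_treeE) (auto simp: divs_def)
  have 2: "distinct (divs d h e) \<and> set (divs d h e) \<inter> pverts ?T = {}" for e
    by (cases e) (auto simp: divs_def set_segment pverts_complete_tree segment_def distinct_map inj_on_def)
  have 3: "set (divs d h (u, v)) \<inter> set (divs d h (x, y)) = {}"
    if "(u, v) \<in> parcs ?T" "(x, y) \<in> parcs ?T" "{u, v} \<noteq> {x, y}" for u v x y
    using that by (elim parcs_complete_treeE) (auto simp: set_divs set_segment)
  show ?thesis
    unfolding division_def
  proof (intro conjI)
    show "\<forall>(u, v)\<in>parcs ?T. \<forall>(x, y)\<in>parcs ?T.
      {u, v} \<noteq> {x, y} \<longrightarrow> set (divs d h (u, v)) \<inter> set (divs d h (x, y)) = {}"
      by (intro ballI case_prodI2 impI, simp only:) (rule 3)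
  qed (use 1 2 in \<open>auto simp: subdivided_tree_def Let_def\<close>)
qed

lemma length_divs:
  assumes "e \<in> parcs (complete_tree d h)"
  shows "length (divs d h e) \<le> 2 * d * (d + 1) ^ (h - 1)"
proof -
  have "half d h (i # v) \<le> d * (d + 1) ^ (h - 1)" if "i # v \<in> pverts (complete_tree d h)" for i v
    unfolding half_def using that
    by (intro mult_le_mono power_increasing) (auto simp: pverts_complete_tree)
  then have "2 * half d h (i # v) \<le> 2 * d * (d + 1) ^ (h - 1)" if "i # v \<in> pverts (complete_tree d h)" for i v
    using that by (simp add: mult.assoc)
  then show ?thesis using assms
    by (cases e) (auto elim!: parcs_complete_treeE simp: divs_def segment_def)
qed

lemma le_subdivision_subdivided_tree:
  "le_subdivision (2 * d * (d + 1) ^ (h - 1)) (complete_tree d h) (subdivided_tree d h)"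
  unfolding le_subdivision_def using division_subdivided_tree length_divs by blast

lemma subdivided_tree_cases [consumes 1, case_names orig div]:
  assumes "x \<in> pverts (subdivided_tree d h)"
  obtains "x \<in> pverts (complete_tree d h)"
    | i v r where "x = (d + r) # i # v" "i # v \<in> pverts (complete_tree d h)" "r < 2 * half d h (i # v)"
  using assms
  by (auto simp: subdivided_tree_def Let_def set_divs set_segment elim!: parcs_complete_treeE split: if_splits)

text \<open>A head below \<open>d\<close> marks an original vertex, whose parent is the last
  division vertex of the edge above. Head \<open>d\<close> marks the top division vertex of the edge
  with lower end \<open>v\<close>, so its parent is the upper end \<open>tl v\<close>.\<close>

fun parent :: "nat \<Rightarrow> nat \<Rightarrow> nat list \<Rightarrow> nat list" where
  "parent d h [] = []"
| "parent d h (a # v) = (if a < d then (d + 2 * half d h (a # v) - 1) # a # v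
    else if a = d then tl v else (a - 1) # v)"

global_interpretation T: rooted_forest "\<lambda>x. x = []" "parent d h" for d h
  defines up = T.up .

lemma successively_segment:
  assumes "i < d"
  shows "successively (\<lambda>x y. up d h y x) (v # segment d h (i # v) @ [i # v])"
proof -
  have "n > 0 \<Longrightarrow> successively (\<lambda>x y. up d h y x) (v # map (\<lambda>r. (d + r) # i # v) [0..<n]) \<and>
     last (map (\<lambda>r. (d + r) # i # v) [0..<n]) = (d + n - 1) # i # v" for n
    by (induction n) (auto simp: successively_append_iff successively_Cons T.up_def last_map)
  from this[of "2 * half d h (i # v)"] show ?thesis
    using half_pos[of d h "i # v"] assms
    by (auto simp: successively_append_iff successively_Cons T.up_def segment_def)
qed

lemma arc_subdivided_tree:
  assumes "(x, y) \<in> parcs (subdivided_tree d h)"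
  shows "up d h x y \<or> up d h y x"
proof -
  from assms obtain u v where uv: "(u, v) \<in> parcs (complete_tree d h)"
    "(x, y) \<in> set (vwalk_arcs (u # divs d h (u, v) @ [v]))"
    by (auto simp: subdivided_tree_def Let_def)
  from uv(1) show ?thesis
  proof (cases rule: parcs_complete_treeE)
    case (1 i)
    then have "set (vwalk_arcs (u # divs d h (u, v) @ [v])) \<subseteq> {(x, y). up d h y x}"
      unfolding set_vwalk_arcs_subset using successively_segment[of i d h u]
      by (simp add: divs_def pverts_complete_tree)
    with uv(2) show ?thesis by blast
  next
    case (2 i)
    have "u # divs d h (u, v) @ [v] = rev (v # segment d h (i # v) @ [i # v])"
      using 2 by (simp add: divs_def)
    then have "set (vwalk_arcs (u # divs d h (u, v) @ [v])) \<subseteq> {(x, y). up d h x y}"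
      unfolding set_vwalk_arcs_subset using successively_segment[of i d h v] 2
      by (simp only: successively_rev) (simp add: pverts_complete_tree)
    with uv(2) show ?thesis by blast
  qed
qed

section \<open>The colouring, its running counts and ascending paths\<close>

context
  fixes d h :: nat and w :: "nat list"
begin

text \<open>
  These functions count letters, markers and original vertices on the path from the root to a vertex:
  \<open>rho_depth\<close> is 2 #rho + #sigma, and \<open>nu_depth\<close> is 2 #nu + #sigma. The root itself is not counted.
\<close>

definition letter_depth :: "nat list \<Rightarrow> nat" where
  "letter_depth x = (case x of [] \<Rightarrow> 0 | a # v \<Rightarrow>
     if a < d then depth d h x else depth d h (tl v) + (a - d) div 2 + 1)"

definition rho_depth :: "nat list \<Rightarrow> nat" where
  "rho_depth x = (case x of [] \<Rightarrow> 0 | a # v \<Rightarrow>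
     if a < d then depth d h x else depth d h (tl v) + min (2 * ((a - d + 1) div 2)) (half d h v))"

definition nu_depth :: "nat list \<Rightarrow> nat" where
  "nu_depth x = (case x of [] \<Rightarrow> 0 | a # v \<Rightarrow>
     if a < d then depth d h x else depth d h (tl v) + (2 * ((a - d + 1) div 2) - half d h v))"

definition level :: "nat list \<Rightarrow> nat" where
  "level x = (case x of [] \<Rightarrow> 0 | a # v \<Rightarrow> if a < d then length x else length (tl v))"

text \<open>The colours 6, 7, 8, 9 stand for original vertices, rho, sigma, nu.\<close>

definition colour :: "nat list \<Rightarrow> nat" where
  "colour x = (case x of [] \<Rightarrow> 6 | a # v \<Rightarrow>
     if a < d then 6
     else if even (a - d) then w ! (depth d h (tl v) + (a - d) div 2)
     else if a - d < half d h v then 7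
     else if a - d = half d h v then 8
     else 9)"

abbreviation (input) verts where "verts \<equiv> pverts (subdivided_tree d h)"

context
  assumes letters: "set w \<subseteq> {..<6}" and len: "(d + 1) ^ h \<le> length w"
begin

text \<open>Digits are at most \<open>d\<close>, so no carry occurs: a digit plus one unit of its
  position is at most one unit of the next higher position.\<close>

lemma depth_append:
  "set (u @ v) \<subseteq> {..<d} \<Longrightarrow> length (u @ v) \<le> h \<Longrightarrow>
    depth d h (u @ v) + (d + 1) ^ (h - length (u @ v)) \<le> depth d h v + (d + 1) ^ (h - length v)
    \<and> depth d h v \<le> depth d h (u @ v)"
proof (induction u)
  case (Cons i u)
  define q where "q = (d + 1) ^ (h - length ((i # u) @ v))"
  have "h - length (u @ v) = Suc (h - length ((i # u) @ v))" using Cons.prems by simp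
  then have pow: "(d + 1) ^ (h - length (u @ v)) = (d + 1) * q" by (simp add: q_def)
  have "(i + 1) * q \<le> d * q" using Cons.prems by (intro mult_le_mono1) simp
  then have "depth d h ((i # u) @ v) + q \<le> depth d h (u @ v) + (d + 1) ^ (h - length (u @ v))"
    unfolding pow by (simp add: q_def)
  moreover have "depth d h (u @ v) \<le> depth d h ((i # u) @ v)" by simp
  ultimately show ?case using Cons unfolding q_def by fastforce
qed simp

lemma letter_index:
  assumes "i # v \<in> pverts (complete_tree d h)" "r < 2 * half d h (i # v)"
  shows "depth d h v + r div 2 < length w"
proof -
  have "depth d h (i # v) + (d + 1) ^ (h - length (i # v)) \<le> (d + 1) ^ h"
    using depth_append[of "i # v" "[]"] assms(1) by (simp add: pverts_complete_tree)
  moreover have "depth d h v + r div 2 < depth d h (i # v)" using assms(2) unfolding depth_Cons by simp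
  ultimately show ?thesis using len by linarith
qed

lemma letter_lt:
  assumes "i # v \<in> pverts (complete_tree d h)" "r < 2 * half d h (i # v)"
  shows "w ! (depth d h v + r div 2) < 6"
  using letters nth_mem[OF letter_index[OF assms]] by auto

text \<open>The closed forms are running counts: positions 0 to \<open>r\<close> of an edge hold
  \<open>(r + 1) div 2\<close> markers, worth 2 each, where sigma adds 1 to both the rho-count and
  the nu-count. The last clause holds because letters stand at even positions: two adjacent vertices
  without letters are an original vertex and the marker above it.\<close>

lemma stats_parent:
  assumes "x \<in> verts" "x \<noteq> []"
  shows "letter_depth x = letter_depth (parent d h x) + (if colour x < 6 then 1 else 0)
    \<and> rho_depth x = rho_depth (parent d h x) + (if colour x = 7 then 2 else if colour x = 8 then 1 else 0)
    \<and> nu_depth x = nu_depth (parent d h x) + (if colour x = 9 then 2 else if colour x = 8 then 1 else 0)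
    \<and> level x = level (parent d h x) + (if colour x = 6 then 1 else 0)
    \<and> (colour x < 6 \<longrightarrow> letter_depth (parent d h x) < length w \<and> colour x = w ! letter_depth (parent d h x))
    \<and> (6 \<le> colour x \<longrightarrow> 6 \<le> colour (parent d h x) \<longrightarrow> colour x = 6 \<and> colour (parent d h x) \<noteq> 6)"
  using assms(1)
proof (cases rule: subdivided_tree_cases)
  case orig
  then obtain a v where x: "x = a # v" and a: "a < d"
    using assms(2) by (cases x) (auto simp: pverts_complete_tree)
  obtain n where n: "half d h (a # v) = Suc n" using half_pos gr0_implies_Suc by blast
  have "depth d h (a # v) = depth d h v + Suc n" by (simp only: depth_Cons n)
  then show ?thesis using a
    by (simp add: x n colour_def letter_depth_def rho_depth_def nu_depth_def level_def del: depth.simps)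
next
  case (div i v r)
  define n where "n = half d h (i # v)"
  have i: "i < d" and v: "set v \<subseteq> {..<d}" using div(2) by (auto simp: pverts_complete_tree)
  note lt = letter_lt[OF div(2,3)] letter_index[OF div(2,3)]
  note defs = colour_def letter_depth_def rho_depth_def nu_depth_def level_def
  show ?thesis
  proof (cases "r = 0")
    case True
    from v have "v = [] \<or> hd v < d" by (cases v) auto
    then show ?thesis using lt
      by (cases v) (simp_all add: div(1) defs True i del: depth.simps(2))
  next
    case False
    then obtain k where r: "r = Suc k" by (cases r) auto
    show ?thesis
    proof (cases "even r")
      case True
      then obtain s where "r = 2 * s" by blast
      with r obtain s' where s: "r = 2 * Suc s'" "k = Suc (2 * s')" by (cases s) auto
      then show ?thesis using lt by (simp add: div(1) defs n_def[symmetric])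
    next
      case False
      then obtain s where s: "r = Suc (2 * s)" "k = 2 * s" using r oddE by fastforce
      have "w ! (depth d h v + s) < 6" using lt(1) s(1) by simp
      then show ?thesis using lt s by (auto simp: div(1) defs n_def[symmetric])
    qed
  qed
qed

text \<open>A letter is read off at the letter count of the parent, which drops by one with each
  letter on the way up, so a factor of \<open>w\<close> is spelled backwards.\<close>

lemma letters_ascending:
  assumes "successively (up d h) (xs @ [m])" "set xs \<subseteq> verts"
  shows "letter_depth m \<le> letter_depth (hd (xs @ [m]))
    \<and> filter (\<lambda>k. k < 6) (map colour xs)
      = rev (drop (letter_depth m) (take (letter_depth (hd (xs @ [m]))) w))"
  using assms
proof (induction xs)
  case (Cons x xs)
  then have up: "up d h x (hd (xs @ [m]))" and IH: "letter_depth m \<le> letter_depth (hd (xs @ [m]))"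
    "filter (\<lambda>k. k < 6) (map colour xs)
      = rev (drop (letter_depth m) (take (letter_depth (hd (xs @ [m]))) w))"
    by (auto simp: successively_Cons)
  from up have p: "parent d h x = hd (xs @ [m])" "x \<noteq> []" by (auto simp: T.up_def)
  have x: "x \<in> verts" using Cons.prems by simp
  show ?case using stats_parent[OF x p(2)] IH unfolding p(1)
    by (cases "colour x < 6") (simp_all add: take_Suc_conv_app_nth)
qed simp

text \<open>The letters of the two halves would form an anagram in reversed \<open>w\<close>, unless
  there are none; but an ascending path without letters has at most two vertices.\<close>

lemma no_anagram_ascending:
  assumes af: "anagram_free w" and asc: "successively (up d h) p" and sub: "set p \<subseteq> verts"
  shows "\<not> anagram (map colour p)"
proof
  assume "anagram (map colour p)"
  then obtain u v where uv: "map colour p = u @ v" "u \<noteq> []" "mset v = mset u"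
    unfolding anagram_def by blast
  let ?f = "filter (\<lambda>k. k < (6 :: nat))"
  have "p \<noteq> []" using uv by auto
  then obtain xs z where p: "p = xs @ [z]" by (metis rev_exhaust)
  \<comment> \<open>\<open>letters_ascending\<close> leaves out the upper end. If that is the root,
    no letter is lost; otherwise the path is prolonged to the parent.\<close>
  have "\<exists>q. sublist q w \<and> ?f (map colour p) = rev q"
  proof (cases "z = []")
    case True
    then have "?f (map colour p) = ?f (map colour xs)" by (simp add: p colour_def)
    with letters_ascending[of xs z] asc sub show ?thesis unfolding p
      by (metis le_sup_iff set_append sublist_take sublist_drop sublist_order.order_trans)
  next
    case False
    then have "successively (up d h) (p @ [parent d h z])"
      using asc by (auto simp: p successively_append_iff T.up_def)
    with letters_ascending[of p "parent d h z"] sub show ?thesis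
      by (metis sublist_take sublist_drop sublist_order.order_trans)
  qed
  then obtain q where q: "sublist q w" "rev q = ?f u @ ?f v"
    using uv(1) by (metis filter_append)
  have fuv: "mset (?f v) = mset (?f u)" using uv(3) by (simp add: mset_filter)
  have "?f u = []"
  proof (rule ccontr)
    assume "?f u \<noteq> []"
    with fuv have "anagram (rev q)" unfolding q(2) anagram_def by blast
    then show False using af q(1) by (simp add: anagram_rev anagram_free_def)
  qed
  then have "?f (u @ v) = []" using fuv by simp
  then have big: "6 \<le> colour x" if "x \<in> set p" for x
    using that unfolding uv(1)[symmetric] by (auto simp: filter_empty_conv not_less)
  have "length v = length u" using uv(3) by (metis size_mset)
  then have "2 \<le> length p" using uv(1,2) by (metis One_nat_def Suc_1 add_mono length_append
    length_greater_0_conv length_map nat_1_add_1 Suc_le_eq)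
  then obtain x y ys where xy: "p = x # y # ys" by (auto simp: numeral_2_eq_2 Suc_le_length_iff)
  have xy6: "colour x = 6" "colour y \<noteq> 6"
    using stats_parent[of x] big[of x] big[of y] asc sub xy by (auto simp: T.up_def)
  show False
  proof (cases ys)
    case Nil
    then have "u = [colour x]" "v = [colour y]"
      using uv \<open>length v = length u\<close> xy by (auto simp: Cons_eq_append_conv)
    then show False using uv(3) xy6 by simp
  next
    case (Cons z zs)
    then show False using xy6 stats_parent[of y] big[of y] big[of z] asc sub xy by (auto simp: T.up_def)
  qed
qed

section \<open>Branches at a vertex and bent paths\<close>

lemma child_cases:
  assumes "z \<in> verts" "up d h z t"
  obtains i where "z = d # i # t" "i # t \<in> pverts (complete_tree d h)"
    | k u where "t = (d + k) # u" "z = (if Suc k = 2 * half d h u then u else (d + Suc k) # u)"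
  using assms(1)
proof (cases rule: subdivided_tree_cases)
  case orig
  with assms(2) obtain a v where z: "z = a # v" "a < d"
    by (cases z) (auto simp: pverts_complete_tree T.up_def)
  obtain k where "2 * half d h (a # v) = Suc k"
    using half_pos[of d h "a # v"] gr0_implies_Suc[of "2 * half d h (a # v)"] by auto
  then show thesis using z assms(2) by (intro that(2)[of k z]) (auto simp: T.up_def)
next
  case (div i v r)
  then show thesis using assms(2) that by (cases r) (auto simp: T.up_def)
qed

text \<open>A division vertex has only one child, so a fork sits at an original vertex and its arms
  start with the top division vertices of two edges.\<close>

lemma siblings:
  assumes "z1 \<in> verts" "z2 \<in> verts" "up d h z1 t" "up d h z2 t" "z1 \<noteq> z2"
  shows "\<exists>i j. i \<noteq> j \<and> z1 = d # i # t \<and> z2 = d # j # t \<and> colour t = 6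
    \<and> i # t \<in> pverts (complete_tree d h) \<and> j # t \<in> pverts (complete_tree d h)"
proof -
  have no: "i # (d + k) # u \<notin> pverts (complete_tree d h)" for i k u
    by (simp add: pverts_complete_tree)
  have col: "colour t = 6" if "i # t \<in> pverts (complete_tree d h)" for i
    using that by (cases t) (auto simp: pverts_complete_tree colour_def)
  from assms(1,3) show ?thesis
  proof (cases rule: child_cases)
    case (1 i)
    from assms(2,4) show ?thesis
      by (cases rule: child_cases) (use 1 no col assms(5) in auto)
  next
    case 2
    from assms(2,4) show ?thesis
      by (cases rule: child_cases) (use 2 no assms(5) in auto)
  qed
qed

text \<open>The lower end of the edge containing the vertex; an original vertex belongs to the edge above it.\<close>

definition low :: "nat list \<Rightarrow> nat list" where
  "low x = (case x of [] \<Rightarrow> [] | a # v \<Rightarrow> if a < d then x else v)"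

lemma suffix_low:
  assumes "x \<in> verts" "up d h x y"
  shows "suffix (low y) (low x)"
  using assms(1)
proof (cases rule: subdivided_tree_cases)
  case orig
  moreover have "\<not> d + 2 * half d h x - 1 < d" using half_pos[of d h x] by linarith
  ultimately show ?thesis using assms(2)
    by (cases x) (auto simp: low_def T.up_def pverts_complete_tree)
next
  case (div i v r)
  then have "set v \<subseteq> {..<d}" by (auto simp: pverts_complete_tree)
  then have "low v = v" by (auto simp: low_def split: list.split)
  then show ?thesis using assms(2) div
    by (cases r) (auto simp: low_def[of "_ # _"] T.up_def suffix_Cons)
qed

text \<open>If the last vertex lies on the edge from \<open>t\<close> to \<open>i # t\<close>, this
  places the whole path in branch \<open>i\<close> of \<open>t\<close>.\<close>

lemma suffix_low_ascending:
  assumes "successively (up d h) us" "set us \<subseteq> verts" "z \<in> set us"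
  shows "suffix (low (last us)) (low z)"
  using assms
proof (induction us arbitrary: z)
  case (Cons u us)
  show ?case
  proof (cases "us = []")
    case False
    with Cons.prems have up: "up d h u (hd us)" "successively (up d h) us" "set us \<subseteq> verts" "u \<in> verts"
      by (auto simp: successively_Cons)
    have "suffix (low (last us)) (low (hd us))" using False by (intro Cons.IH up) auto
    also have "suffix (low (hd us)) (low u)" using up by (intro suffix_low)
    finally have "suffix (low (last us)) (low u)" .
    with Cons.IH[OF up(2,3)] Cons.prems(3) False show ?thesis by auto
  qed (use Cons in auto)
qed simp

text \<open>\<open>T\<close> counts the letters down to \<open>t\<close>, \<open>n\<close> those on
  the first edge of the branch; the rest of the branch adds less than \<open>q\<close>, the unit of
  that digit. The nu-count stays at \<open>T\<close> until the rho-count has gained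
  \<open>n\<close>. The last disjunction separates the interior of the first edge from its lower end
  and everything below.\<close>

lemma branch:
  assumes x: "x \<in> verts" and suf: "suffix (i # t) (low x)"
  defines "q \<equiv> (d + 1) ^ (h - Suc (length t))" and "T \<equiv> depth d h t"
  defines "n \<equiv> (i + 1) * q"
  shows "T \<le> rho_depth x \<and> rho_depth x < T + n + q \<and> T \<le> nu_depth x \<and> nu_depth x < T + n + q
    \<and> (nu_depth x = T \<or> T + n \<le> rho_depth x)
    \<and> ((level x = length t \<and> nu_depth x \<le> T + n)
      \<or> (length t < level x \<and> T + n \<le> rho_depth x \<and> T + n \<le> nu_depth x))"
proof -
  obtain zs where zs: "low x = zs @ i # t" using suf by (auto simp: suffix_def)
  have n: "n = half d h (i # t)" by (simp add: n_def q_def half_def)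
  then have it: "depth d h (i # t) = T + n" by (simp only: depth_Cons T_def)
  have bound: "depth d h (low x) < T + n + q" "T + n \<le> depth d h (low x)"
    if "low x \<in> pverts (complete_tree d h)"
  proof -
    have *: "depth d h (low x) + (d + 1) ^ (h - length (low x)) \<le> depth d h (i # t) + q
      \<and> depth d h (i # t) \<le> depth d h (low x)"
      using depth_append[of zs "i # t"] that by (simp add: zs pverts_complete_tree q_def del: depth.simps)
    moreover have "0 < (d + 1) ^ (h - length (low x))" by simp
    ultimately show "depth d h (low x) < T + n + q" "T + n \<le> depth d h (low x)"
      unfolding it by linarith+
  qed
  from x show ?thesis
  proof (cases rule: subdivided_tree_cases)
    case orig
    then have low: "low x = x" by (auto simp: low_def pverts_complete_tree split: list.split)
    obtain a v where "x = a # v" "a < d" using orig zs low by (cases x) (auto simp: pverts_complete_tree)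
    then have "rho_depth x = depth d h x" "nu_depth x = depth d h x" "level x = length x"
      by (simp_all add: rho_depth_def nu_depth_def level_def)
    moreover have "length t < length x" using zs low by simp
    ultimately show ?thesis using bound low orig by auto
  next
    case (div j v r)
    define s where "s = 2 * ((r + 1) div 2)"
    have low: "low x = j # v" by (simp add: div(1) low_def)
    have s: "s \<le> 2 * half d h (j # v)" using div(3) by (simp add: s_def)
    have st: "rho_depth x = depth d h v + min s (half d h (j # v))"
      "nu_depth x = depth d h v + (s - half d h (j # v))" "level x = length v"
      by (simp_all add: rho_depth_def nu_depth_def level_def div(1) s_def)
    have le: "depth d h v + half d h (j # v) < T + n + q"
      using bound(1) div(2) unfolding low depth_Cons by simp
    show ?thesis
    proof (cases zs)
      case Nil
      then have "j = i" "v = t" using zs low by auto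
      then show ?thesis using st s le by (auto simp: n T_def)
    next
      case (Cons k zs')
      then have v: "v = zs' @ i # t" using zs low by auto
      then have "T + n \<le> depth d h v"
        using depth_append[of zs' "i # t"] div(2) it by (simp add: pverts_complete_tree del: depth.simps)
      then show ?thesis using st s le v by auto
    qed
  qed
qed

lemma no_anagram_fork:
  assumes asc: "successively (up d h) (us @ [t])" "successively (up d h) (vs @ [t])"
    and sub: "set us \<subseteq> verts" "set vs \<subseteq> verts"
    and ne: "us \<noteq> []" "vs \<noteq> []" "last us \<noteq> last vs"
    and us: "us = u1 @ u2" "u1 \<noteq> []"
    and eq: "mset (map colour (u2 @ t # rev vs)) = mset (map colour u1)"
  shows False
proof -
  define x y m where "x = hd us" and "y = hd vs" and "m = hd (u2 @ [t])"
  have "up d h (last us) t" "up d h (last vs) t"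
    using asc ne by (auto simp: successively_append_iff)
  moreover have "last us \<in> verts" "last vs \<in> verts" using sub ne by auto
  ultimately obtain i j where ij: "i \<noteq> j" "last us = d # i # t" "last vs = d # j # t" "colour t = 6"
    "i # t \<in> pverts (complete_tree d h)" "j # t \<in> pverts (complete_tree d h)"
    using siblings ne(3) by blast
  \<comment> \<open>The first half contributes \<open>F x - F m\<close>, the second
    \<open>(F m - F t) + g 6 + (F y - F t)\<close>, where \<open>g 6\<close> stands for
    \<open>t\<close> itself.\<close>
  have balance: "F x + 2 * F t = 2 * F m + F y + g 6"
    if "\<And>z. z \<in> verts \<Longrightarrow> z \<noteq> [] \<Longrightarrow> F z = F (parent d h z) + g (colour z)"
    for F :: "nat list \<Rightarrow> nat" and g :: "nat \<Rightarrow> nat"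
  proof -
    let ?G = "\<lambda>zs. sum_list (map (\<lambda>z. g (colour z)) zs)"
    have m: "hd (u1 @ [m]) = x" "successively (up d h) (u1 @ [m])" "successively (up d h) (u2 @ [t])"
      using us asc(1) by (auto simp: x_def m_def successively_append_iff)
    have "?G u1 + F m = F x"
      using T.ascending_sum[OF m(2), of F "\<lambda>z. g (colour z)"] that us sub unfolding m(1) by auto
    moreover have "?G u2 + F t = F m"
      unfolding m_def by (rule T.ascending_sum[OF m(3)]) (use that us sub in auto)
    moreover have "?G vs + F t = F y"
      using T.ascending_sum[OF asc(2), of F "\<lambda>z. g (colour z)"] that sub ne by (auto simp: y_def)
    moreover have "sum_list (map g (map colour (u2 @ t # rev vs))) = sum_list (map g (map colour u1))"
      using eq by (metis mset_map sum_mset_sum_list)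
    then have "?G u2 + g 6 + ?G vs = ?G u1"
      by (simp add: ij(4) comp_def rev_map[symmetric] sum_list_rev)
    ultimately show ?thesis by linarith
  qed
  have bal: "rho_depth x + 2 * rho_depth t = 2 * rho_depth m + rho_depth y"
    "nu_depth x + 2 * nu_depth t = 2 * nu_depth m + nu_depth y"
    "level x + 2 * level t = 2 * level m + level y + 1"
    using balance[of rho_depth "\<lambda>k. if k = 7 then 2 else if k = 8 then 1 else 0"]
      balance[of nu_depth "\<lambda>k. if k = 9 then 2 else if k = 8 then 1 else 0"]
      balance[of level "\<lambda>k. if k = 6 then 1 else 0"] stats_parent by fastforce+
  define q T where "q = (d + 1) ^ (h - Suc (length t))" and "T = depth d h t"
  define n n' where "n = (i + 1) * q" and "n' = (j + 1) * q"
  have t: "t = [] \<or> hd t < d" using ij(5) by (cases t) (auto simp: pverts_complete_tree)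
  then have stt: "rho_depth t = T" "nu_depth t = T" "level t = length t"
    by (cases t; simp add: rho_depth_def nu_depth_def level_def T_def del: depth.simps(2))+
  have low: "low (last us) = i # t" "low (last vs) = j # t" by (simp_all add: ij low_def)
  have in_us: "suffix (i # t) (low z)" if "z \<in> set us" for z
    using suffix_low_ascending[of us z] asc(1) sub(1) that low by (simp add: successively_append_iff)
  have in_vs: "suffix (j # t) (low z)" if "z \<in> set vs" for z
    using suffix_low_ascending[of vs z] asc(2) sub(2) that low by (simp add: successively_append_iff)
  have x: "x \<in> set us" and y: "y \<in> set vs" using ne by (simp_all add: x_def y_def)
  have m: "m = t \<or> m \<in> set us" using us by (cases u2) (auto simp: m_def)
  have bx: "rho_depth x < T + n + q" "T \<le> nu_depth x" "nu_depth x < T + n + q"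
    "level x = length t \<or> T + n \<le> nu_depth x"
    using branch[of x i t] x in_us sub unfolding q_def n_def T_def by auto
  have yb: "T \<le> rho_depth y" "T \<le> nu_depth y" "nu_depth y < T + n' + q"
    "nu_depth y = T \<or> T + n' \<le> rho_depth y" "length t \<le> level y"
    "nu_depth y \<le> T + n' \<or> (length t < level y)" "length t < level y \<longrightarrow> T + n' \<le> nu_depth y"
    using branch[of y j t] y in_vs sub unfolding q_def n'_def T_def by fastforce+
  have mb: "T \<le> rho_depth m" "T \<le> nu_depth m" "nu_depth m = T \<or> T + n \<le> rho_depth m" "length t \<le> level m"
    using branch[of m i t] m in_us sub stt unfolding q_def n_def T_def by fastforce+
  have q: "q > 0" "q \<le> n" by (simp_all add: q_def n_def)
  \<comment> \<open>Otherwise the rho-count of \<open>m\<close> is at least \<open>T + n\<close>,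
    and the balance puts that of \<open>x\<close> at \<open>T + 2 * n\<close> or more, beyond its
    bound \<open>T + n + q\<close>.\<close>
  have "nu_depth m = T"
    using mb bal(1) bx(1) yb(1) q stt by linarith
  with bal(2) stt have nu: "nu_depth x = nu_depth y" by linarith
  \<comment> \<open>The original vertex \<open>t\<close> tips the level balance, so \<open>x\<close>
    lies below the interior of its first edge.\<close>
  have "T + n \<le> nu_depth x" using bx(4) bal(3) mb(4) yb(5) stt by linarith
  consider "i < j" | "j < i" using ij(1) by linarith
  then show False
  proof cases
    \<comment> \<open>The nu-count of \<open>y\<close> exceeds \<open>T\<close>, so its rho-count
      has reached \<open>T + n'\<close> and is larger than that of \<open>x\<close>, against the
      balance.\<close>
    case 1
    then have "n + q \<le> n'" using mult_le_mono1[of "i + 2" "j + 1" q] by (simp add: n_def n'_def)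
    moreover have "T + n' \<le> rho_depth y" using yb(4) nu \<open>T + n \<le> nu_depth x\<close> q by linarith
    ultimately show False using bal(1) mb(1) bx(1) stt by linarith
  next
    \<comment> \<open>The whole branch of \<open>y\<close> is too small for its nu-count to reach
      that of \<open>x\<close>.\<close>
    case 2
    then have "n' + q \<le> n" using mult_le_mono1[of "j + 2" "i + 1" q] by (simp add: n_def n'_def)
    then show False using yb(3) nu \<open>T + n \<le> nu_depth x\<close> by linarith
  qed
qed

lemma anagram_free_colouring_colour:
  assumes af: "anagram_free w"
  shows "anagram_free_colouring (subdivided_tree d h) colour"
  unfolding anagram_free_colouring_def
proof (intro allI impI notI)
  fix p assume p: "vpath p (with_proj (subdivided_tree d h))" and "anagram (map colour p)"
  then obtain W P where WP: "map colour p = W @ P" "W \<noteq> []" "mset P = mset W"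
    unfolding anagram_def by blast
  have sub: "set p \<subseteq> verts" and dist: "distinct p" "p \<noteq> []"
    and walk: "set (vwalk_arcs p) \<subseteq> parcs (subdivided_tree d h)"
    using p by (auto simp: vpath_def vwalk_def)
  have "successively (\<lambda>x y. up d h x y \<or> up d h y x) p"
    using walk unfolding set_vwalk_arcs_subset
    by (rule successively_mono) (use arc_subdivided_tree in auto)
  then obtain us t vs where split: "p = us @ t # rev vs"
    "successively (up d h) (us @ [t])" "successively (up d h) (vs @ [t])"
    by (rule T.path_split[OF dist])
  have us: "us \<noteq> []"
  proof
    assume "us = []"
    then have rev: "rev p = vs @ [t]" using split(1) by simp
    have "anagram (map colour (rev p))"
      unfolding rev_map[symmetric] anagram_rev by fact
    then show False using no_anagram_ascending[OF af split(3)] sub unfolding rev[symmetric] by simp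
  qed
  have vs: "vs \<noteq> []"
    using no_anagram_ascending[OF af split(2)] sub split(1) \<open>anagram (map colour p)\<close> by auto
  have sets: "set us \<subseteq> verts" "set vs \<subseteq> verts" using sub split(1) by auto
  have last: "last us \<noteq> last vs"
    using dist(1) last_in_set[OF us] last_in_set[OF vs] unfolding split(1) by (auto simp: disjoint_iff)
  have len: "length P = length W" using WP(3) by (metis size_mset)
  have *: "length W + length W = length us + 1 + length vs"
    using arg_cong[OF WP(1), of length] len unfolding split(1) by simp
  show False
  proof (cases "length W \<le> length us")
    case True
    define u1 u2 where "u1 = take (length W) us" and "u2 = drop (length W) us"
    have u: "us = u1 @ u2" "length u1 = length W" using True by (simp_all add: u1_def u2_def)
    then have "map colour u1 = W" "map colour (u2 @ t # rev vs) = P"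
      using WP(1) unfolding split(1) by (simp_all add: append_eq_append_conv)
    then show False using no_anagram_fork[OF split(2,3) sets us vs last u(1)] WP u(2) by auto
  next
    \<comment> \<open>Now the second half lies in the arm of \<open>vs\<close>; reversing the path
      exchanges both the arms and the halves.\<close>
    case False
    define v1 v2 where "v1 = take (length W) vs" and "v2 = drop (length W) vs"
    have v: "vs = v1 @ v2" "length v1 = length W" using False * by (simp_all add: v1_def v2_def)
    have "length (us @ t # rev v2) = length W" using * v by simp
    moreover have "map colour (us @ t # rev v2) @ map colour (rev v1) = W @ P"
      using WP(1) unfolding split(1) v(1) by simp
    ultimately have "map colour (us @ t # rev v2) = W" "map colour (rev v1) = P"
      by (metis append_eq_append_conv length_map)+
    then have "mset (map colour (v2 @ t # rev us)) = mset W" "mset (map colour v1) = mset P"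
      by auto
    moreover have "v1 \<noteq> []" using v(2) WP(2) by auto
    ultimately show False
      using no_anagram_fork[OF split(3,2) sets(2,1) vs us last[symmetric] v(1)] WP(3) by auto
  qed
qed

lemma colour_lt:
  assumes "x \<in> verts"
  shows "colour x < 10"
  using assms
proof (cases rule: subdivided_tree_cases)
  case orig
  then show ?thesis by (auto simp: colour_def pverts_complete_tree split: list.split)
next
  case (div i v r)
  then show ?thesis using letter_lt[OF div(2,3)] by (simp add: colour_def)
qed

end
end

theorem theorem10:
  fixes d h :: nat
  assumes "d \<ge> 1" and "h \<ge> 1"
  shows "\<exists>S. le_subdivision (2 * d * (d + 1) ^ (h - 1)) (complete_tree d h) S \<and> \<phi> S \<le> 10"
proof -
  \<comment> \<open>Letter indices are numbers of at most \<open>h\<close> digits in base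
    \<open>d + 1\<close>, so this length suffices.\<close>
  obtain w where w: "(d + 1) ^ h \<le> length w" "set w \<subseteq> {..<6 :: nat}" "anagram_free w"
    using ex_anagram_free_word by blast
  let ?S = "subdivided_tree d h"
  have "colour d h w ` pverts ?S \<subseteq> {..<10}"
    using colour_lt[OF w(2,1)] by blast
  moreover have "anagram_free_colouring ?S (colour d h w)"
    using w by (intro anagram_free_colouring_colour)
  ultimately have "\<phi> ?S \<le> 10"
    unfolding anagram_free_number_def by (intro Least_le) blast
  with le_subdivision_subdivided_tree show ?thesis by blast
qed

end
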